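(* Let $S$ be a countably based, simple, non-elementary Cu-semigroup satisfying (O5) and (O6), let $u\in S$ be a compact, full element, and set $K:=F_{u\mapsto 1}(S)$. Assume that $S$ satisfies Edwards' condition for $\partial_e K$. Then for every $\lambda\in\partial_e K$ and $t>0$ there exists $a\in S$ with $\widehat{a}_{|K}=t+\sigma_\lambda$, where $\sigma_\lambda\colon K\to[0,\infty]$ is given by $\sigma_\lambda(\lambda)=0$ and $\sigma_\lambda(\mu)=\infty$ for $\mu\neq\lambda$.
   Context: A positively ordered monoid is a commutative monoid $S$ with a translation-invariant partial order such that $0\leq a$ for all $a$. In $S$, $a\ll b$ means: for every increasing sequence $(b_n)_n$ whose supremum exists and satisfies $b\leq\sup_n b_n$, there is $N$ with $a\leq b_N$. A Cu-semigroup is a positively ordered monoid $S$ with: (O1) every increasing sequence has a supremum; (O2) every element is the supremum of a $\ll$-increasing sequence; (O3) $a'\ll a$, $b'\ll b$ imply $a'+b'\ll a+b$; (O4) $\sup_n(a_n+b_n)=\sup_na_n+\sup_nb_n$ for increasing sequences. Further axioms: (O5) if $a+b\leq c$, $a'\ll a$, $b'\ll b$, then there is $x\in S$ with $a'+x\leq c\leq a+x$ and $b'\ll x$. (O6) if $a'\ll a\leq b+c$, then there are $e,f\in S$ with $a'\leq e+f$, $e\leq a,b$ and $f\leq a,c$. ($x\leq a,b$ means $x\leq a$ and $x\leq b$.) $S$ is countably based if there is a countable subset such that every element of $S$ is the supremum of an increasing sequence from it. An ideal is a downward hereditary submonoid closed under suprema of increasing sequences; $S$ is simple if its only ideals are $\{0\}$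 and $S$; an element $u$ is full if $\sup_n nu$ is the largest element of $S$. A simple Cu-semigroup is elementary if it contains a minimal nonzero element. $u$ is compact if $u\ll u$. A functional on $S$ is a map $\lambda\colon S\to[0,\infty]$ preserving addition, order, zero and suprema of increasing sequences; $F(S)$ is the set of functionals, and $F_{u\mapsto1}(S):=\{\lambda\in F(S):\lambda(u)=1\}$, a convex set with set of extreme points $\partial_eK$. For $a\in S$, $\widehat a(\lambda):=\lambda(a)$. $S$ satisfies Edwards' condition for $\partial_eK$ if $\min\{\lambda(a),\lambda(b)\}=\sup\{\lambda(c):c\in S,\ c\leq a,b\}$ for all $\lambda\in\partial_eK$ and $a,b\in S$. *)

theory Defs
  imports "HOL-Library.Extended_Nonnegative_Real" "HOL-Library.Countable_Set"
begin

section \<open>Cu-semigroups\<close>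

class positively_ordered_monoid = ordered_comm_monoid_add +
  assumes zero_least: "0 \<le> a"

text \<open>
  Increasing sequences are not required to be strictly increasing. In class contexts
  \<open>monotone (\<le>) (\<le>)\<close> is what \<open>incseq\<close> abbreviates.
\<close>

definition (in order) is_seq_sup :: "(nat \<Rightarrow> 'a) \<Rightarrow> 'a \<Rightarrow> bool" where
  "is_seq_sup f s \<longleftrightarrow> (\<forall>n. f n \<le> s) \<and> (\<forall>t. (\<forall>n. f n \<le> t) \<longrightarrow> s \<le> t)"

definition (in order) way_below :: "'a \<Rightarrow> 'a \<Rightarrow> bool" (infix "\<lless>" 50) where
  "a \<lless> b \<longleftrightarrow>
     (\<forall>f s. monotone (\<le>) (\<le>) f \<and> is_seq_sup f s \<and> b \<le> s \<longrightarrow> (\<exists>N. a \<le> f N))"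

class cu_semigroup = positively_ordered_monoid +
  assumes O1: "monotone (\<le>) (\<le>) f \<Longrightarrow> \<exists>s. is_seq_sup f s"
    and O2: "\<exists>f. (\<forall>n. f n \<lless> f (Suc n)) \<and> is_seq_sup f a"
    and O3: "a' \<lless> a \<Longrightarrow> b' \<lless> b \<Longrightarrow> a' + b' \<lless> a + b"
    and O4: "monotone (\<le>) (\<le>) f \<Longrightarrow> monotone (\<le>) (\<le>) g \<Longrightarrow>
               is_seq_sup f s \<Longrightarrow> is_seq_sup g t \<Longrightarrow>
               is_seq_sup (\<lambda>n. f n + g n) (s + t)"

definition axiom_O5 :: "'a::cu_semigroup itself \<Rightarrow> bool" where
  "axiom_O5 _ \<longleftrightarrow> (\<forall>a b c a' b' :: 'a. a + b \<le> c \<and> a' \<lless> a \<and> b' \<lless> b \<longrightarrow>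
     (\<exists>x. a' + x \<le> c \<and> c \<le> a + x \<and> b' \<lless> x))"

definition axiom_O6 :: "'a::cu_semigroup itself \<Rightarrow> bool" where
  "axiom_O6 _ \<longleftrightarrow> (\<forall>a' a b c :: 'a. a' \<lless> a \<and> a \<le> b + c \<longrightarrow>
     (\<exists>e f. a' \<le> e + f \<and> e \<le> a \<and> e \<le> b \<and> f \<le> a \<and> f \<le> c))"

definition countably_based :: "'a::cu_semigroup itself \<Rightarrow> bool" where
  "countably_based _ \<longleftrightarrow> (\<exists>B :: 'a set. countable B \<and>
     (\<forall>a. \<exists>f. incseq f \<and> range f \<subseteq> B \<and> is_seq_sup f a))"

definition cu_ideal :: "'a::cu_semigroup set \<Rightarrow> bool" where
  "cu_ideal I \<longleftrightarrow> 0 \<in> I \<and> (\<forall>a\<in>I. \<forall>b\<in>I. a + b \<in> I) \<and>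
     (\<forall>a b. a \<le> b \<and> b \<in> I \<longrightarrow> a \<in> I) \<and>
     (\<forall>f s. incseq f \<and> range f \<subseteq> I \<and> is_seq_sup f s \<longrightarrow> s \<in> I)"

definition simple_cu :: "'a::cu_semigroup itself \<Rightarrow> bool" where
  "simple_cu _ \<longleftrightarrow> (\<forall>I :: 'a set. cu_ideal I \<longrightarrow> I = {0} \<or> I = UNIV)"

definition elementary_cu :: "'a::cu_semigroup itself \<Rightarrow> bool" where
  "elementary_cu _ \<longleftrightarrow> simple_cu TYPE('a) \<and>
     (\<exists>a :: 'a. a \<noteq> 0 \<and> (\<forall>b. b \<noteq> 0 \<and> b \<le> a \<longrightarrow> b = a))"

text \<open>The finite sum below is the multiple \<open>n u\<close>.\<close>

definition full_element :: "'a::cu_semigroup \<Rightarrow> bool" where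
  "full_element u \<longleftrightarrow> (\<exists>s. is_seq_sup (\<lambda>n. \<Sum>i<n. u) s \<and> (\<forall>x. x \<le> s))"

definition compact_element :: "'a::cu_semigroup \<Rightarrow> bool" where
  "compact_element u \<longleftrightarrow> u \<lless> u"

section \<open>Functionals\<close>

definition functionals :: "('a::cu_semigroup \<Rightarrow> ennreal) set" where
  "functionals = {\<phi>. \<phi> 0 = 0 \<and> (\<forall>a b. \<phi> (a + b) = \<phi> a + \<phi> b) \<and> mono \<phi> \<and>
     (\<forall>f s. incseq f \<and> is_seq_sup f s \<longrightarrow> \<phi> s = (SUP n. \<phi> (f n)))}"

definition normalized_functionals :: "'a::cu_semigroup \<Rightarrow> ('a \<Rightarrow> ennreal) set" where
  "normalized_functionals u = {\<phi> \<in> functionals. \<phi> u = 1}"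

text \<open>
  \<open>[0,\<infinity>]\<close>-valued functions do not form a real vector space, so
  \<open>extreme_point_of\<close> from HOL-Analysis is not applicable; the usual definition is
  spelled out with pointwise convex combinations.
\<close>

definition extreme_functionals :: "('a \<Rightarrow> ennreal) set \<Rightarrow> ('a \<Rightarrow> ennreal) set" where
  "extreme_functionals K = {\<phi> \<in> K. \<forall>\<mu>\<in>K. \<forall>\<nu>\<in>K. \<forall>r::real. 0 < r \<and> r < 1 \<and>
     \<phi> = (\<lambda>a. ennreal r * \<mu> a + ennreal (1 - r) * \<nu> a) \<longrightarrow> \<mu> = \<phi> \<and> \<nu> = \<phi>}"

definition rank_map :: "'a \<Rightarrow> ('a \<Rightarrow> ennreal) \<Rightarrow> ennreal" where
  "rank_map a \<phi> = \<phi> a"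

definition edwards_condition :: "('a::cu_semigroup \<Rightarrow> ennreal) set \<Rightarrow> bool" where
  "edwards_condition X \<longleftrightarrow> (\<forall>\<phi>\<in>X. \<forall>a b.
     min (\<phi> a) (\<phi> b) = (SUP c\<in>{c. c \<le> a \<and> c \<le> b}. \<phi> c))"

definition sigma_fun :: "('a \<Rightarrow> ennreal) \<Rightarrow> ('a \<Rightarrow> ennreal) \<Rightarrow> ennreal" where
  "sigma_fun \<phi> \<mu> = (if \<mu> = \<phi> then 0 else \<infinity>)"

end

theory Submission
  imports Defs
begin

text \<open>
  Fix an extreme \<open>\<phi>\<close>. The idea is to produce elements \<open>x\<close> on which \<open>\<phi>\<close> is as small as one likes
  while \<open>\<mu> x \<ge> 1\<close> for a whole set of functionals \<open>\<mu> \<noteq> \<phi>\<close>, and to add up countably many multiples of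
  such elements.

  To find them, take \<open>b\<close> with \<open>n \<phi>(b) \<le> m\<close>. Edwards' condition for the pair \<open>n b\<close>, \<open>m u\<close> provides a
  common lower bound \<open>d\<close> on which \<open>\<phi>\<close> almost attains the value \<open>n \<phi>(b)\<close>. An almost-complement \<open>x\<close>
  of \<open>d\<close> in \<open>n b\<close>, which exists by (O5), behaves like the positive part of \<open>n b - m u\<close>: \<open>\<phi>\<close> nearly
  vanishes on it, whereas \<open>d \<le> m u\<close> forces \<open>\<mu> x \<ge> n \<mu>(b) - m\<close> for each \<open>\<mu>\<close>. Hence \<open>\<mu> x \<ge> 1\<close> for all
  \<open>\<mu>\<close> with \<open>n \<mu>(b) \<ge> m + 1\<close>, a set that does not depend on how small \<open>\<phi> x\<close> has been chosen
  (\<open>exists_small_at_extreme\<close>). As \<open>b\<close> ranges over a countable basis and \<open>n\<close>, \<open>m\<close> over the natural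
  numbers, these countably many sets cover \<open>K - {\<phi>}\<close>: distinct normalized functionals are separated
  by some element in either direction, since complements in multiples of \<open>u\<close> reverse inequalities
  (\<open>exists_functional_less\<close>).

  This yields \<open>a\<^sub>0\<close> with \<open>\<phi> a\<^sub>0 \<le> t\<close> and \<open>\<mu> a\<^sub>0 = \<infinity>\<close> for all other \<open>\<mu>\<close>. Because \<open>S\<close> is simple and
  non-elementary, \<open>\<phi>\<close> takes arbitrarily small nonzero values, so multiples of small elements can be
  added to \<open>a\<^sub>0\<close> to raise the value at \<open>\<phi>\<close> to exactly \<open>t\<close> in the limit (\<open>extend_to_value\<close>).
\<close>

section \<open>Suprema and functionals\<close>

lemma zero_way_below: "(0::'a::cu_semigroup) \<lless> b"
  by (simp add: way_below_def zero_least)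

lemma way_below_le_trans: "a \<lless> b \<Longrightarrow> b \<le> (c::'a::cu_semigroup) \<Longrightarrow> a \<lless> c"
  unfolding way_below_def by (meson order_trans)

lemma way_below_imp_le:
  assumes "a \<lless> (b::'a::cu_semigroup)"
  shows "a \<le> b"
proof -
  have "monotone (\<le>) (\<le>) (\<lambda>_::nat. b)" "is_seq_sup (\<lambda>_. b) b"
    by (auto simp: monotone_def is_seq_sup_def)
  then show ?thesis using assms unfolding way_below_def by blast
qed

lemma way_below_approximation:
  fixes b :: "'a::cu_semigroup"
  obtains f where "\<And>n. f n \<lless> f (Suc n)" "incseq f" "is_seq_sup f b" "\<And>n. f n \<lless> b"
proof -
  obtain f where f: "\<forall>n. f n \<lless> f (Suc n)" "is_seq_sup f b"
    using O2 by blast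
  have "incseq f" using f(1) by (simp add: incseq_SucI way_below_imp_le)
  moreover have "f n \<lless> b" for n
    using f way_below_le_trans unfolding is_seq_sup_def by blast
  ultimately show ?thesis using f that by blast
qed

lemma incseq_has_sup:
  fixes f :: "nat \<Rightarrow> 'a::cu_semigroup"
  assumes "incseq f"
  obtains s where "is_seq_sup f s"
  using O1 assms by blast

lemma functional_zero: "\<phi> \<in> functionals \<Longrightarrow> \<phi> 0 = 0"
  and functional_add: "\<phi> \<in> functionals \<Longrightarrow> \<phi> (a + b) = \<phi> a + \<phi> b"
  and functional_mono: "\<phi> \<in> functionals \<Longrightarrow> a \<le> b \<Longrightarrow> \<phi> a \<le> \<phi> b"
  and functional_sup: "\<phi> \<in> functionals \<Longrightarrow> incseq f \<Longrightarrow> is_seq_sup f s \<Longrightarrow> \<phi> s = (SUP n. \<phi> (f n))"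
  by (auto simp: functionals_def mono_def)

lemma functional_sum:
  "\<phi> \<in> functionals \<Longrightarrow> \<phi> (\<Sum>i<(n::nat). f i) = (\<Sum>i<n. \<phi> (f i))"
  by (induction n) (simp_all add: functional_zero functional_add)

lemma functional_multiple:
  "\<phi> \<in> functionals \<Longrightarrow> \<phi> (\<Sum>i<(n::nat). a) = of_nat n * \<phi> a"
  by (simp add: functional_sum)

lemma functional_way_below_approx:
  assumes "\<phi> \<in> functionals" "\<phi> d < \<infinity>" "0 < (e::real)"
  obtains d' where "d' \<lless> d" "\<phi> d \<le> \<phi> d' + ennreal e"
proof -
  obtain f where f: "incseq f" "is_seq_sup f d" "\<And>n. f n \<lless> d"
    using way_below_approximation by metis
  have eq: "\<phi> d = (SUP n. \<phi> (f n))" using functional_sup assms(1) f by blast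
  then have "\<exists>n\<in>UNIV. \<phi> d < \<phi> (f n) + ennreal e"
    using SUP_approx_ennreal[OF assms(3) UNIV_not_empty eq] assms(2) by fastforce
  then show ?thesis using that f(3) less_imp_le by blast
qed

section \<open>Separating normalized functionals\<close>

text \<open>
  If \<open>\<phi>\<close> exceeds \<open>\<mu>\<close> at \<open>b\<close>, then it is below \<open>\<mu>\<close> at a complement of (an approximation of) \<open>b\<close> in a
  multiple of \<open>u\<close>, because \<open>\<phi>\<close> and \<open>\<mu>\<close> agree on that multiple. Fullness of \<open>u\<close> makes the multiple
  large enough.
\<close>

lemma exists_functional_less:
  fixes u :: "'a::cu_semigroup"
  assumes O5: "axiom_O5 TYPE('a)" and full: "full_element u"
    and phi: "\<phi> \<in> normalized_functionals u" and mu: "\<mu> \<in> normalized_functionals u"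
    and neq: "\<mu> \<noteq> \<phi>"
  obtains x where "\<phi> x < \<mu> x"
proof -
  have fn: "\<phi> \<in> functionals" "\<mu> \<in> functionals" and u1: "\<phi> u = 1" "\<mu> u = 1"
    using phi mu by (auto simp: normalized_functionals_def)
  obtain b where b: "\<mu> b \<noteq> \<phi> b" using neq by blast
  show ?thesis
  proof (cases "\<phi> b < \<mu> b")
    case True
    then show ?thesis using that by blast
  next
    case False
    then have less: "\<mu> b < \<phi> b" using b by simp
    obtain f where f: "\<And>n. f n \<lless> f (Suc n)" "incseq f" "is_seq_sup f b" "\<And>n. f n \<lless> b"
      using way_below_approximation by metis
    from less obtain n where n: "\<mu> b < \<phi> (f n)"
      using functional_sup[OF fn(1) f(2,3)] by (auto simp: less_SUP_iff)
    obtain s where s: "is_seq_sup (\<lambda>n. \<Sum>i<n. u) s" "\<And>x. x \<le> s"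
      using full unfolding full_element_def by blast
    have inc: "incseq (\<lambda>n. \<Sum>i<n. u)"
      by (rule incseq_SucI) (simp add: add_increasing2 zero_least)
    obtain N :: nat where N: "f (Suc n) \<le> (\<Sum>i<N. u)"
      using f(4)[of "Suc n"] s inc unfolding way_below_def by blast
    obtain x where x: "f n + x \<le> (\<Sum>i<N. u)" "(\<Sum>i<N. u) \<le> f (Suc n) + x"
      using O5[unfolded axiom_O5_def, rule_format, of "f (Suc n)" 0 "\<Sum>i<N. u" "f n" 0]
        N f(1) zero_way_below by auto
    have phi_le: "\<phi> (f n) + \<phi> x \<le> of_nat N"
      using functional_mono[OF fn(1) x(1)]
      by (simp add: functional_add functional_multiple fn u1)
    have mu_ge: "of_nat N \<le> \<mu> (f (Suc n)) + \<mu> x"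
      using functional_mono[OF fn(2) x(2)]
      by (simp add: functional_add functional_multiple fn u1)
    have "\<mu> (f (Suc n)) \<le> \<mu> b"
      using f(3) functional_mono[OF fn(2)] unfolding is_seq_sup_def by blast
    then have lt: "\<mu> (f (Suc n)) < \<phi> (f n)" using n by simp
    have fin: "\<phi> x < \<infinity>"
      using phi_le by (metis add_left_mono add.commute ennreal_of_nat_neq_top infinity_ennreal_def
          le_iff_add neq_top_trans top.not_eq_extremum)
    have "\<phi> x < \<mu> x"
    proof (rule ccontr)
      assume "\<not> \<phi> x < \<mu> x"
      then have "of_nat N \<le> \<mu> (f (Suc n)) + \<phi> x"
        using mu_ge by (meson add_left_mono leI order_trans)
      also have "\<dots> < \<phi> (f n) + \<phi> x"
        using lt fin by (simp add: add.commute ennreal_add_left_cancel_less)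
      finally show False using phi_le by simp
    qed
    then show ?thesis using that by blast
  qed
qed

text \<open>
  Some multiple of the gap has length at least two, so it contains an interval between consecutive
  natural numbers.
\<close>

lemma ennreal_separate_multiples:
  fixes x y :: ennreal
  assumes "x < y"
  obtains n m :: nat where "of_nat n * x \<le> of_nat m" "of_nat m + 1 \<le> of_nat n * y"
proof -
  obtain z where z: "x < z" "z < y" using assms dense by blast
  then obtain r q where r: "x = ennreal r" "0 \<le> r" and q: "z = ennreal q" "0 \<le> q"
    by (metis ennreal_cases less_top order_less_trans top.not_eq_extremum)
  have rq: "r < q" using z r q by (simp add: ennreal_less_iff)
  obtain n :: nat where n: "2 \<le> real n * (q - r)"
    using rq by (metis diff_gt_0_iff_gt ex_less_of_nat_mult less_imp_le)
  define m where "m = nat \<lceil>real n * r\<rceil>"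
  have m: "real n * r \<le> real m" "real m \<le> real n * r + 1"
    using r(2) unfolding m_def by (auto simp: real_nat_ceiling_ge)
  have "of_nat n * x = ennreal (real n * r)"
    using r by (simp add: ennreal_mult ennreal_of_nat_eq_real_of_nat)
  also have "\<dots> \<le> of_nat m"
    using m by (simp add: ennreal_leI ennreal_of_nat_eq_real_of_nat)
  finally have 1: "of_nat n * x \<le> of_nat m" .
  have "of_nat m + 1 = ennreal (real m + 1)"
    by (simp add: ennreal_plus ennreal_of_nat_eq_real_of_nat)
  also have "\<dots> \<le> ennreal (real n * q)"
    using m n by (intro ennreal_leI) (simp add: algebra_simps)
  also have "\<dots> = of_nat n * z"
    using q by (simp add: ennreal_mult ennreal_of_nat_eq_real_of_nat)
  also have "\<dots> \<le> of_nat n * y"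
    using z by (simp add: mult_left_mono)
  finally show ?thesis using that 1 by blast
qed

section \<open>Elements that are small at one extreme functional\<close>

text \<open>
  The element \<open>x\<close> plays the role of the positive part of \<open>n b - m u\<close>. The quantifier order matters:
  the functionals \<open>\<mu>\<close> at which \<open>x\<close> is large are prescribed by \<open>b\<close>, \<open>n\<close> and \<open>m\<close> before \<open>e\<close> is chosen.
\<close>

lemma exists_small_at_extreme:
  fixes u b :: "'a::cu_semigroup"
  assumes O5: "axiom_O5 TYPE('a)"
    and edwards: "edwards_condition X" "\<phi> \<in> X"
    and phi: "\<phi> \<in> normalized_functionals u"
    and nb: "of_nat n * \<phi> b \<le> of_nat m" and e: "0 < (e::real)"
  obtains x where "\<phi> x \<le> ennreal e"
    "\<And>\<mu>. \<mu> \<in> normalized_functionals u \<Longrightarrow> of_nat m + 1 \<le> of_nat n * \<mu> b \<Longrightarrow> 1 \<le> \<mu> x"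
proof -
  have fn: "\<phi> \<in> functionals" and u1: "\<phi> u = 1"
    using phi by (auto simp: normalized_functionals_def)
  define c where "c = (\<Sum>i<n. b)"
  define v where "v = (\<Sum>i<m. u)"
  have phi_c: "\<phi> c = of_nat n * \<phi> b" and phi_v: "\<phi> v = of_nat m"
    by (simp_all add: c_def v_def functional_multiple fn u1)
  have fin: "\<phi> c < \<infinity>" using nb phi_c by (metis ennreal_of_nat_neq_top infinity_ennreal_def
        neq_top_trans top.not_eq_extremum)
  define h where "h = e / 2"
  have h: "0 < h" "ennreal h + ennreal h = ennreal e"
    using e by (simp_all add: h_def flip: ennreal_plus)
  have eq: "\<phi> c = (SUP d\<in>{d. d \<le> c \<and> d \<le> v}. \<phi> d)"
    using edwards nb phi_c phi_v unfolding edwards_condition_def by (metis min.absorb1)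
  have "0 \<in> {d. d \<le> c \<and> d \<le> v}" by (simp add: zero_least)
  then have ne: "{d. d \<le> c \<and> d \<le> v} \<noteq> {}" by blast
  have "\<exists>d\<in>{d. d \<le> c \<and> d \<le> v}. \<phi> c < \<phi> d + ennreal h"
    using SUP_approx_ennreal[OF h(1) ne eq] fin by simp
  then obtain d where d: "d \<le> c" "d \<le> v" "\<phi> c \<le> \<phi> d + ennreal h"
    by (auto dest: less_imp_le)
  have "\<phi> d < \<infinity>" using functional_mono[OF fn d(1)] fin by simp
  then obtain d' where d': "d' \<lless> d" "\<phi> d \<le> \<phi> d' + ennreal h"
    using functional_way_below_approx fn h(1) by blast
  obtain x where x: "d' + x \<le> c" "c \<le> d + x"
    using O5[unfolded axiom_O5_def, rule_format, of d 0 c d' 0] d d' zero_way_below by auto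
  have "\<phi> d' + \<phi> x \<le> \<phi> c"
    using functional_mono[OF fn x(1)] by (simp add: functional_add fn)
  also have "\<dots> \<le> \<phi> d' + ennreal h + ennreal h" using d(3) d'(2) by (meson add_right_mono order_trans)
  also have "\<dots> = \<phi> d' + ennreal e" using h(2) by (simp add: add.assoc)
  finally have "\<phi> d' + \<phi> x \<le> \<phi> d' + ennreal e" .
  moreover have "\<phi> d' < \<infinity>"
    using functional_mono[OF fn way_below_imp_le[OF d'(1)]] \<open>\<phi> d < \<infinity>\<close> by simp
  ultimately have 1: "\<phi> x \<le> ennreal e" by (auto simp: ennreal_add_left_cancel_le)
  have 2: "1 \<le> \<mu> x" if mu: "\<mu> \<in> normalized_functionals u" "of_nat m + 1 \<le> of_nat n * \<mu> b" for \<mu>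
  proof -
    have fm: "\<mu> \<in> functionals" and "\<mu> u = 1"
      using mu by (auto simp: normalized_functionals_def)
    have "of_nat m + 1 \<le> \<mu> c" using mu(2) by (simp add: c_def functional_multiple fm)
    also have "\<dots> \<le> \<mu> d + \<mu> x" using functional_mono[OF fm x(2)] by (simp add: functional_add fm)
    also have "\<dots> \<le> \<mu> v + \<mu> x" using functional_mono[OF fm d(2)] by (simp add: add_right_mono)
    also have "\<mu> v = of_nat m" by (simp add: v_def functional_multiple fm \<open>\<mu> u = 1\<close>)
    finally show ?thesis by (simp add: ennreal_add_left_cancel_le)
  qed
  show ?thesis using that 1 2 by blast
qed

text \<open>
  The summand with index \<open>(j, k)\<close> is a multiple, at least \<open>k\<close> at each \<open>\<mu>\<close> in \<open>T j\<close>, of an element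
  chosen so small at \<open>\<phi>\<close> that the values of all summands at \<open>\<phi>\<close> stay below a geometric series.
\<close>

lemma exists_small_and_infinite:
  fixes T :: "nat \<Rightarrow> ('a::cu_semigroup \<Rightarrow> ennreal) set"
  assumes fn: "\<phi> \<in> functionals" and T: "\<And>j. T j \<subseteq> functionals"
    and small: "\<And>j e. 0 < (e::real) \<Longrightarrow> \<exists>x. \<phi> x \<le> ennreal e \<and> (\<forall>\<mu>\<in>T j. 1 \<le> \<mu> x)"
    and t: "0 < (t::real)"
  obtains a where "\<phi> a \<le> ennreal t" "\<And>\<mu> j. \<mu> \<in> T j \<Longrightarrow> \<mu> a = \<infinity>"
proof -
  have "\<exists>x. \<phi> x \<le> ennreal (t * (1/2) ^ Suc i) \<and> (\<forall>\<mu>\<in>T j. of_nat k \<le> \<mu> x)" for i j k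
  proof -
    define e where "e = t * (1/2) ^ Suc i / real (Suc k)"
    have "0 < e" using t by (simp add: e_def)
    then obtain x where x: "\<phi> x \<le> ennreal e" "\<forall>\<mu>\<in>T j. 1 \<le> \<mu> x" using small by blast
    have "\<phi> (\<Sum>i<Suc k. x) \<le> of_nat (Suc k) * ennreal e"
      using x(1) functional_multiple[OF fn, where n = "Suc k"] by (metis mult_left_mono zero_le)
    also have "\<dots> = ennreal (real (Suc k) * e)"
      using \<open>0 < e\<close> by (simp only: ennreal_of_nat_eq_real_of_nat ennreal_mult of_nat_0_le_iff less_imp_le)
    also have "real (Suc k) * e = t * (1/2) ^ Suc i" by (simp add: e_def del: of_nat_Suc)
    finally have 1: "\<phi> (\<Sum>i<Suc k. x) \<le> ennreal (t * (1/2) ^ Suc i)" .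
    have "of_nat k \<le> \<mu> (\<Sum>i<Suc k. x)" if "\<mu> \<in> T j" for \<mu>
    proof -
      have "(of_nat k :: ennreal) \<le> of_nat (Suc k) * 1" by simp
      also have "\<dots> \<le> of_nat (Suc k) * \<mu> x" using x(2) that by (intro mult_left_mono) auto
      also have "\<dots> = \<mu> (\<Sum>i<Suc k. x)"
        using functional_multiple[where n = "Suc k"] T that by (metis subsetD)
      finally show ?thesis .
    qed
    then show ?thesis using 1 by blast
  qed
  then have "\<forall>i. \<exists>x. \<phi> x \<le> ennreal (t * (1/2) ^ Suc i) \<and>
      (\<forall>\<mu>\<in>T (fst (prod_decode i)). of_nat (snd (prod_decode i)) \<le> \<mu> x)" by blast
  then obtain x where x: "\<And>i. \<phi> (x i) \<le> ennreal (t * (1/2) ^ Suc i)"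
    "\<And>i \<mu>. \<mu> \<in> T (fst (prod_decode i)) \<Longrightarrow> of_nat (snd (prod_decode i)) \<le> \<mu> (x i)" by metis
  define p where "p n = (\<Sum>i<n. x i)" for n
  have inc: "incseq p" unfolding p_def
    by (rule incseq_SucI) (simp add: add_increasing2 zero_least)
  then obtain a where a: "is_seq_sup p a" using incseq_has_sup by blast
  have "\<phi> (p n) \<le> ennreal t" for n
  proof -
    have "\<phi> (p n) \<le> (\<Sum>i<n. ennreal (t * (1/2) ^ Suc i))"
      unfolding p_def functional_sum[OF fn] by (intro sum_mono x)
    also have "\<dots> = ennreal (\<Sum>i<n. t * (1/2) ^ Suc i)"
      using t by (intro sum_ennreal) simp
    also have "(\<Sum>i<n. t * (1/2) ^ Suc i) = t * (1 - (1/2) ^ n)"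
      by (induction n) (simp_all add: algebra_simps)
    also have "ennreal \<dots> \<le> ennreal t"
      using t by (intro ennreal_leI) (simp add: algebra_simps)
    finally show ?thesis .
  qed
  then have 1: "\<phi> a \<le> ennreal t" using functional_sup[OF fn inc a] by (simp add: SUP_least)
  have 2: "\<mu> a = \<infinity>" if mu: "\<mu> \<in> T j" for \<mu> j
  proof -
    have "of_nat k \<le> \<mu> a" for k
    proof -
      let ?i = "prod_encode (j, k)"
      have fm: "\<mu> \<in> functionals" using T mu by blast
      have "x ?i \<le> p (Suc ?i)" by (simp add: p_def add_increasing zero_least)
      also have "\<dots> \<le> a" using a by (simp add: is_seq_sup_def)
      finally have "\<mu> (x ?i) \<le> \<mu> a" by (rule functional_mono[OF fm])
      moreover have "of_nat k \<le> \<mu> (x ?i)" using x(2)[of \<mu> ?i] mu by simp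
      ultimately show ?thesis by simp
    qed
    then show ?thesis
      by (metis ennreal_Ex_less_of_nat infinity_ennreal_def leD top.not_eq_extremum)
  qed
  show ?thesis using that 1 2 by blast
qed

section \<open>Attaining a prescribed value\<close>

lemma functional_faithful:
  fixes \<phi> :: "'a::cu_semigroup \<Rightarrow> ennreal"
  assumes simple: "simple_cu TYPE('a)" and fn: "\<phi> \<in> functionals" and "\<phi> u \<noteq> 0" and "x \<noteq> 0"
  shows "0 < \<phi> x"
proof -
  have "cu_ideal {x. \<phi> x = 0}"
    unfolding cu_ideal_def
  proof (intro conjI allI ballI impI)
    show "a \<in> {x. \<phi> x = 0}" if "a \<le> b \<and> b \<in> {x. \<phi> x = 0}" for a b
      using that functional_mono[OF fn, of a b] by simp
    show "s \<in> {x. \<phi> x = 0}" if "incseq f \<and> range f \<subseteq> {x. \<phi> x = 0} \<and> is_seq_sup f s" for f s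
    proof -
      have "\<And>n. \<phi> (f n) = 0" using that by blast
      then show ?thesis using functional_sup[OF fn, of f s] that by simp
    qed
  qed (simp_all add: functional_zero functional_add fn)
  then have "{x. \<phi> x = 0} = {0}" using simple assms(3) unfolding simple_cu_def by blast
  then show ?thesis using assms(4) by (auto simp: zero_less_iff_neq_zero)
qed

text \<open>
  A nonzero element that is not minimal dominates a sum of two nonzero elements: part of a smaller
  element and its complement.
\<close>

lemma exists_nonzero_sum_below:
  fixes y :: "'a::cu_semigroup"
  assumes O5: "axiom_O5 TYPE('a)" and z: "z \<noteq> 0" "z \<le> y" "z \<noteq> y"
  obtains v w where "v \<noteq> 0" "w \<noteq> 0" "v + w \<le> y"
proof -
  obtain f where f: "is_seq_sup f z" "\<And>n. f n \<lless> z"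
    using way_below_approximation by metis
  obtain n where n: "f n \<noteq> 0"
    using f(1) z(1) zero_least[of z] unfolding is_seq_sup_def by (metis order_antisym order_refl)
  obtain x where x: "f n + x \<le> y" "y \<le> z + x"
    using O5[unfolded axiom_O5_def, rule_format, of z 0 y "f n" 0] f(2) z(2) zero_way_below by auto
  have "x \<noteq> 0" using x(2) z(2,3) by (metis add.right_neutral order_antisym)
  then show ?thesis using that n x by blast
qed

lemma exists_small_nonzero:
  fixes u :: "'a::cu_semigroup"
  assumes simple: "simple_cu TYPE('a)" and nonel: "\<not> elementary_cu TYPE('a)"
    and O5: "axiom_O5 TYPE('a)" and phi: "\<phi> \<in> normalized_functionals u" and e: "0 < (e::real)"
  obtains x where "0 < \<phi> x" "\<phi> x \<le> ennreal e"
proof -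
  have fn: "\<phi> \<in> functionals" and u1: "\<phi> u = 1"
    using phi by (auto simp: normalized_functionals_def)
  have pos: "0 < \<phi> x" if "x \<noteq> 0" for x
    using functional_faithful[OF simple fn _ that] u1 by (metis zero_neq_one)
  have "\<exists>x. x \<noteq> 0 \<and> \<phi> x \<le> ennreal ((1/2) ^ n)" for n
  proof (induction n)
    case 0
    then show ?case using u1 functional_zero[OF fn] by (intro exI[of _ u]) auto
  next
    case (Suc n)
    then obtain y where y: "y \<noteq> 0" "\<phi> y \<le> ennreal ((1/2) ^ n)" by blast
    obtain z where "z \<noteq> 0" "z \<le> y" "z \<noteq> y"
      using nonel simple y(1) unfolding elementary_cu_def by blast
    then obtain v w where vw: "v \<noteq> 0" "w \<noteq> 0" "v + w \<le> y"
      using exists_nonzero_sum_below[OF O5] by metis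
    have sum: "\<phi> v + \<phi> w \<le> ennreal ((1/2) ^ n)"
      using functional_mono[OF fn vw(3)] y(2) by (simp add: functional_add fn)
    then obtain p q where pq: "\<phi> v = ennreal p" "0 \<le> p" "\<phi> w = ennreal q" "0 \<le> q"
      by (cases "\<phi> v"; cases "\<phi> w") (auto simp: top_unique)
    then have "p + q \<le> (1/2) ^ n" using sum by (simp flip: ennreal_plus)
    then have "p \<le> (1/2) ^ Suc n \<or> q \<le> (1/2) ^ Suc n" by auto
    then have "\<phi> v \<le> ennreal ((1/2) ^ Suc n) \<or> \<phi> w \<le> ennreal ((1/2) ^ Suc n)"
      using pq ennreal_leI by metis
    then show ?case using vw by blast
  qed
  moreover obtain n where "(1/2::real) ^ n < e"
    using real_arch_pow_inv[of e "1/2"] e by auto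
  ultimately show ?thesis using that pos by (meson ennreal_leI less_imp_le order_trans)
qed

text \<open>
  Greedy filling: adding the largest possible multiple of a small element brings the value to
  within \<open>e\<close> of \<open>t\<close>; iterating with \<open>e\<close> tending to zero gives \<open>t\<close> in the supremum.
\<close>

lemma extend_to_value:
  assumes fn: "\<phi> \<in> functionals"
    and small: "\<And>e::real. 0 < e \<Longrightarrow> \<exists>x. 0 < \<phi> x \<and> \<phi> x \<le> ennreal e"
    and a0: "\<phi> a\<^sub>0 \<le> ennreal t"
  obtains a where "a\<^sub>0 \<le> a" "\<phi> a = ennreal t"
proof -
  have step: "\<exists>b\<ge>a. \<phi> b \<le> ennreal t \<and> ennreal t \<le> \<phi> b + ennreal e"
    if a: "\<phi> a \<le> ennreal t" and e: "0 < e" for a and e :: real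
  proof -
    obtain x where x: "0 < \<phi> x" "\<phi> x \<le> ennreal e" using small e by blast
    obtain r where r: "\<phi> a = ennreal r" "0 \<le> r"
      using a by (metis ennreal_cases ennreal_less_top leD)
    obtain s where s: "\<phi> x = ennreal s" "0 \<le> s"
      using x by (metis ennreal_cases ennreal_less_top leD)
    show ?thesis
    proof (cases "r \<le> t")
      case False
      \<comment> \<open>This happens only for negative \<open>t\<close>, where \<open>ennreal t = 0\<close>.\<close>
      then have "\<phi> a = ennreal t" using a r by (metis ennreal_leI linear order_antisym)
      then show ?thesis by (intro exI[of _ a]) simp
    next
      case True
      have s0: "0 < s" "s \<le> e" using x s e by (auto simp: ennreal_le_iff)
      define m where "m = nat \<lfloor>(t - r) / s\<rfloor>"
      have "real m = of_int \<lfloor>(t - r) / s\<rfloor>" using True s0 by (simp add: m_def)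
      then have "real m \<le> (t - r) / s" "(t - r) / s < real m + 1" by linarith+
      then have m: "r + real m * s \<le> t" "t \<le> r + real m * s + e"
        using s0 by (auto simp: field_simps)
      define b where "b = a + (\<Sum>i<m. x)"
      have "\<phi> b = ennreal r + of_nat m * ennreal s"
        by (simp add: b_def functional_add functional_multiple fn r s)
      also have "\<dots> = ennreal (r + real m * s)"
        using r s by (simp add: ennreal_mult ennreal_plus ennreal_of_nat_eq_real_of_nat)
      finally have "\<phi> b = ennreal (r + real m * s)" .
      moreover have "a \<le> b" by (simp add: b_def add_increasing2 zero_least)
      ultimately show ?thesis
        using m e r s by (intro exI[of _ b]) (simp add: ennreal_leI flip: ennreal_plus)
    qed
  qed
  have "\<exists>f. \<forall>n. (\<phi> (f n) \<le> ennreal t \<and> a\<^sub>0 \<le> f n) \<and>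
      (f n \<le> f (Suc n) \<and> ennreal t \<le> \<phi> (f (Suc n)) + ennreal ((1/2) ^ n))"
  proof (rule dependent_nat_choice)
    show "\<exists>x. \<phi> x \<le> ennreal t \<and> a\<^sub>0 \<le> x" using a0 by blast
    show "\<exists>y. (\<phi> y \<le> ennreal t \<and> a\<^sub>0 \<le> y) \<and> x \<le> y \<and> ennreal t \<le> \<phi> y + ennreal ((1/2) ^ n)"
      if "\<phi> x \<le> ennreal t \<and> a\<^sub>0 \<le> x" for x n
      using step[of x "(1/2) ^ n"] that by (meson order_trans half_gt_zero zero_less_one
          zero_less_power)
  qed
  then obtain f where f: "\<And>n. \<phi> (f n) \<le> ennreal t" "\<And>n. a\<^sub>0 \<le> f n" "\<And>n. f n \<le> f (Suc n)"
    "\<And>n. ennreal t \<le> \<phi> (f (Suc n)) + ennreal ((1/2) ^ n)" by blast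
  have inc: "incseq f" using f(3) by (rule incseq_SucI)
  then obtain a where a: "is_seq_sup f a" using incseq_has_sup by blast
  have "\<phi> a \<le> ennreal t" using functional_sup[OF fn inc a] f(1) by (simp add: SUP_least)
  moreover have "ennreal t \<le> \<phi> a"
  proof (rule ennreal_le_epsilon)
    fix e :: real assume "0 < e"
    then obtain n where n: "(1/2::real) ^ n < e" using real_arch_pow_inv[of e "1/2"] by auto
    have "\<phi> (f (Suc n)) \<le> \<phi> a" using a functional_mono[OF fn] by (simp add: is_seq_sup_def)
    then show "ennreal t \<le> \<phi> a + ennreal e"
      using f(4)[of n] n by (meson add_mono ennreal_leI less_imp_le order_trans)
  qed
  moreover have "a\<^sub>0 \<le> a" using f(2)[of 0] a unfolding is_seq_sup_def by (meson order_trans)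
  ultimately show ?thesis using that by (simp add: order_antisym)
qed

section \<open>Functionals that are infinite away from one extreme point\<close>

theorem proposition5p4:
  fixes u :: "'a::cu_semigroup"
    and K :: "('a \<Rightarrow> ennreal) set"
  assumes "countably_based TYPE('a)"
    and "simple_cu TYPE('a)"
    and "\<not> elementary_cu TYPE('a)"
    and "axiom_O5 TYPE('a)"
    and "axiom_O6 TYPE('a)"
    and "compact_element u"
    and "full_element u"
    and K_def: "K = normalized_functionals u"
    and "edwards_condition (extreme_functionals K)"
  shows "\<forall>\<phi>\<in>extreme_functionals K. \<forall>t::real. 0 < t \<longrightarrow>
           (\<exists>a. \<forall>\<mu>\<in>K. rank_map a \<mu> = ennreal t + sigma_fun \<phi> \<mu>)"
proof (intro ballI allI impI)
  fix \<phi> and t :: real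
  assume ext: "\<phi> \<in> extreme_functionals K" and t: "0 < t"
  have phi: "\<phi> \<in> normalized_functionals u"
    using ext by (simp add: extreme_functionals_def K_def)
  then have fn: "\<phi> \<in> functionals" by (simp add: normalized_functionals_def)
  obtain B :: "'a set" where B: "countable B"
    "\<And>a. \<exists>f. incseq f \<and> range f \<subseteq> B \<and> is_seq_sup f a"
    using assms(1) unfolding countably_based_def by blast
  define I where "I = {(b, n, m). b \<in> B \<and> of_nat n * \<phi> b \<le> of_nat m}"
  define T where "T = (\<lambda>(b, n :: nat, m :: nat).
      {\<mu> \<in> normalized_functionals u. of_nat m + 1 \<le> of_nat n * \<mu> b})"
  have "countable (B \<times> (UNIV :: (nat \<times> nat) set))" using B(1) by auto
  then have cI: "countable I" by (rule countable_subset[rotated]) (auto simp: I_def)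
  have "I \<noteq> {}"
  proof -
    obtain b where "b \<in> B" using B(2) by blast
    then have "(b, 0, 0) \<in> I" by (simp add: I_def)
    then show ?thesis by blast
  qed
  then have rI: "range (from_nat_into I) = I" using cI by (rule range_from_nat_into)
  have "\<exists>x. \<phi> x \<le> ennreal e \<and> (\<forall>\<mu>\<in>T (from_nat_into I j). 1 \<le> \<mu> x)"
    if "0 < e" for j and e :: real
  proof -
    obtain b n m where j: "from_nat_into I j = (b, n, m)" by (metis prod_cases3)
    have "from_nat_into I j \<in> I" using rI by blast
    then have "of_nat n * \<phi> b \<le> of_nat m" unfolding j by (simp add: I_def)
    then obtain x where "\<phi> x \<le> ennreal e"
      "\<And>\<mu>. \<mu> \<in> normalized_functionals u \<Longrightarrow> of_nat m + 1 \<le> of_nat n * \<mu> b \<Longrightarrow> 1 \<le> \<mu> x"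
      using exists_small_at_extreme[OF assms(4,9) ext phi _ \<open>0 < e\<close>] by metis
    then show ?thesis by (auto simp: j T_def)
  qed
  moreover have "T (from_nat_into I j) \<subseteq> functionals" for j
    by (auto simp: T_def normalized_functionals_def split: prod.splits)
  ultimately obtain a\<^sub>0 where a0: "\<phi> a\<^sub>0 \<le> ennreal t"
    "\<And>\<mu> j. \<mu> \<in> T (from_nat_into I j) \<Longrightarrow> \<mu> a\<^sub>0 = \<infinity>"
    using exists_small_and_infinite[OF fn, of "\<lambda>j. T (from_nat_into I j)" t] t by metis
  obtain a where a: "a\<^sub>0 \<le> a" "\<phi> a = ennreal t"
    using extend_to_value[OF fn _ a0(1)] exists_small_nonzero[OF assms(2-4) phi] by metis
  have "\<mu> a = \<infinity>" if mu: "\<mu> \<in> normalized_functionals u" "\<mu> \<noteq> \<phi>" for \<mu>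
  proof -
    have fm: "\<mu> \<in> functionals" using mu by (simp add: normalized_functionals_def)
    obtain x where x: "\<phi> x < \<mu> x"
      using exists_functional_less[OF assms(4,7) phi mu] by blast
    obtain f where f: "incseq f" "range f \<subseteq> B" "is_seq_sup f x" using B(2) by blast
    from x obtain k where k: "\<phi> x < \<mu> (f k)"
      using functional_sup[OF fm f(1,3)] by (auto simp: less_SUP_iff)
    have "\<phi> (f k) \<le> \<phi> x" using f(3) functional_mono[OF fn] by (simp add: is_seq_sup_def)
    then have "\<phi> (f k) < \<mu> (f k)" using k by simp
    then obtain n m :: nat where nm: "of_nat n * \<phi> (f k) \<le> of_nat m"
      "of_nat m + 1 \<le> of_nat n * \<mu> (f k)"
      using ennreal_separate_multiples by blast
    have "(f k, n, m) \<in> I" using f(2) nm(1) by (auto simp: I_def)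
    then obtain j where "from_nat_into I j = (f k, n, m)" using rI by (metis imageE)
    then have "\<mu> \<in> T (from_nat_into I j)" using nm(2) mu(1) by (simp add: T_def)
    then have "\<mu> a\<^sub>0 = \<infinity>" using a0(2) by blast
    then show ?thesis using functional_mono[OF fm a(1)] by (simp add: top_unique)
  qed
  then have "\<forall>\<mu>\<in>K. rank_map a \<mu> = ennreal t + sigma_fun \<phi> \<mu>"
    using a(2) by (auto simp: K_def rank_map_def sigma_fun_def)
  then show "\<exists>a. \<forall>\<mu>\<in>K. rank_map a \<mu> = ennreal t + sigma_fun \<phi> \<mu>" by blast
qed

end
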